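(* Let $f$ satisfy the standing assumptions of the context, and let $\{\mathbf z_k^+\}$ be generated by the ZOCEG algorithm (defined in the context) with step size $\eta$, smoothing radii $r_k>0$ and initial point $\mathbf z_0\in\mathcal Z$. Suppose $\sum_{k=0}^\infty r_k\le\frac{M_3}{\sqrt{d_x}+\sqrt{d_y}}<\infty$ for some $M_3>0$, and that the step size satisfies $0<\eta L\le\frac12$. Then for any integer $K>1$, the averaged iterate $\hat{\mathbf z}_K=\frac1K\sum_{k=0}^{K-1}\mathbf z_k^+$ satisfies $$\Delta(\hat{\mathbf z}_K)\le\frac{1}{2K}\left(\frac{\tilde D^2}{\eta}+3LM_3\tilde D\right).$$
   Context: Notation: $\|\cdot\|$ is the Euclidean norm; $\mathcal P_{\mathcal S}$ is the Euclidean projection onto a closed convex set $\mathcal S$; $\mathbf e_i$ denotes the $i$-th standard basis vector (of $\mathbb R^{d_x}$ or $\mathbb R^{d_y}$ as appropriate); $d_x,d_y\ge 1$, $\mathbf z=(\mathbf x,\mathbf y)\in\mathbb R^{d_x}\times\mathbb R^{d_y}$. Standing assumptions: $\mathcal X\subset\mathbb R^{d_x}$ and $\mathcal Y\subset\mathbb R^{d_y}$ are compact and convex; $\mathcal Z=\mathcal X\times\mathcal Y$; $\tilde D=\max_{\mathbf z,\mathbf z'\in\mathcal Z}\|\mathbf z-\mathbf z'\|$. The function $f:\mathbb R^{d_x}\times\mathbb R^{d_y}\to\mathbb R$ is continuously differentiable over $\mathcal X\times\mathcal Y$, convex in $\mathbf x$ and concave in $\mathbf y$; and for all $\mathbf z_1,\mathbf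 z_2\in\mathcal Z$, $|f(\mathbf z_1)-f(\mathbf z_2)|\le G\|\mathbf z_1-\mathbf z_2\|$ and $\|\nabla f(\mathbf z_1)-\nabla f(\mathbf z_2)\|\le L\|\mathbf z_1-\mathbf z_2\|$. A saddle point $\mathbf z^*=(\mathbf x^*,\mathbf y^* )\in\mathcal Z$ of $f$, i.e. $f(\mathbf x^*,\mathbf y)\le f(\mathbf x^*,\mathbf y^* )\le f(\mathbf x,\mathbf y^* )$ for all $(\mathbf x,\mathbf y)\in\mathcal Z$, is assumed to exist and is fixed. The duality gap of $\mathbf z=(\mathbf x,\mathbf y)\in\mathcal Z$ is $\Delta(\mathbf z)=f(\mathbf x,\mathbf y^* )-f(\mathbf x^*,\mathbf y)$. ZOCEG algorithm (deterministic): for $r>0$ put $$\hat{\mathbf g}^x(\mathbf x,\mathbf y;r)=\sum_{i=1}^{d_x}\frac{f(\mathbf x+r\mathbf e_i,\mathbf y)-f(\mathbf x,\mathbf y)}{r}\mathbf e_i,\qquad \hat{\mathbf g}^y(\mathbf x,\mathbf y;r)=\sum_{j=1}^{d_y}\frac{f(\mathbf x,\mathbf y+r\mathbf e_j)-f(\mathbf x,\mathbf y)}{r}\mathbf e_j .$$ For $k=0,1,2,\dots$: $$\mathbf x_k^+=\mathcal P_{\mathcal X}[\mathbf x_k-\eta\,\hat{\mathbf g}^x(\mathbf x_k,\mathbf y_k;r_k)],\quad \mathbf y_k^+=\mathcal P_{\mathcal Y}[\mathbf y_k+\eta\,\hat{\mathbf g}^y(\mathbf x_k,\mathbf y_k;r_k)],$$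 $$\mathbf x_{k+1}=\mathcal P_{\mathcal X}[\mathbf x_k-\eta\,\hat{\mathbf g}^x(\mathbf x_k^+,\mathbf y_k^+;r_k)],\quad \mathbf y_{k+1}=\mathcal P_{\mathcal Y}[\mathbf y_k+\eta\,\hat{\mathbf g}^y(\mathbf x_k^+,\mathbf y_k^+;r_k)],$$ with $\mathbf z_k=(\mathbf x_k,\mathbf y_k)$, $\mathbf z_k^+=(\mathbf x_k^+,\mathbf y_k^+)$.
   Formalization: Differentiability and the L-Lipschitz gradient are assumed on a convex set containing Z and all the shifted points where the algorithm evaluates f, not only on Z; with smoothness on Z alone the claim is false, since f may be evaluated outside Z. *)

theory Defs
  imports "HOL-Analysis.Analysis"
begin

definition is_saddle_point ::
    "('a \<times> 'b \<Rightarrow> real) \<Rightarrow> 'a set \<Rightarrow> 'b set \<Rightarrow> 'a \<times> 'b \<Rightarrow> bool" where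
  "is_saddle_point f X Y zs \<longleftrightarrow> zs \<in> X \<times> Y \<and>
     (\<forall>x\<in>X. \<forall>y\<in>Y. f (fst zs, y) \<le> f zs \<and> f zs \<le> f (x, snd zs))"

definition duality_gap ::
    "('a \<times> 'b \<Rightarrow> real) \<Rightarrow> 'a \<times> 'b \<Rightarrow> 'a \<times> 'b \<Rightarrow> real" where
  "duality_gap f zs z = f (fst z, snd zs) - f (fst zs, snd z)"

definition zo_grad_x ::
    "((real^'m) \<times> (real^'n) \<Rightarrow> real) \<Rightarrow> (real^'m) \<times> (real^'n) \<Rightarrow> real \<Rightarrow> real^'m" where
  "zo_grad_x f z r =
     (\<Sum>i\<in>UNIV. ((f (fst z + r *\<^sub>R axis i 1, snd z) - f z) / r) *\<^sub>R axis i 1)"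

definition zo_grad_y ::
    "((real^'m) \<times> (real^'n) \<Rightarrow> real) \<Rightarrow> (real^'m) \<times> (real^'n) \<Rightarrow> real \<Rightarrow> real^'n" where
  "zo_grad_y f z r =
     (\<Sum>j\<in>UNIV. ((f (fst z, snd z + r *\<^sub>R axis j 1) - f z) / r) *\<^sub>R axis j 1)"

text \<open>One projected descent-ascent step that starts from \<open>z\<close> and uses the estimators taken
  at \<open>w\<close>.  With \<open>w = z\<close> it is the extrapolation step; with \<open>w\<close> the extrapolated point it is
  the update step.\<close>

definition zoceg_step ::
    "((real^'m) \<times> (real^'n) \<Rightarrow> real) \<Rightarrow> (real^'m) set \<Rightarrow> (real^'n) set \<Rightarrow> real \<Rightarrow> real
      \<Rightarrow> (real^'m) \<times> (real^'n) \<Rightarrow> (real^'m) \<times> (real^'n) \<Rightarrow> (real^'m) \<times> (real^'n)" where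
  "zoceg_step f X Y \<eta> r z w =
     (closest_point X (fst z - \<eta> *\<^sub>R zo_grad_x f w r),
      closest_point Y (snd z + \<eta> *\<^sub>R zo_grad_y f w r))"

primrec zoceg_iter ::
    "((real^'m) \<times> (real^'n) \<Rightarrow> real) \<Rightarrow> (real^'m) set \<Rightarrow> (real^'n) set \<Rightarrow> real \<Rightarrow> (nat \<Rightarrow> real)
      \<Rightarrow> (real^'m) \<times> (real^'n) \<Rightarrow> nat \<Rightarrow> (real^'m) \<times> (real^'n)" where
  "zoceg_iter f X Y \<eta> r z0 0 = z0"
| "zoceg_iter f X Y \<eta> r z0 (Suc k) =
     (let z = zoceg_iter f X Y \<eta> r z0 k
      in zoceg_step f X Y \<eta> (r k) z (zoceg_step f X Y \<eta> (r k) z z))"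

text \<open>The extrapolated points (those carrying the superscript \<open>+\<close>).\<close>

definition zoceg_plus ::
    "((real^'m) \<times> (real^'n) \<Rightarrow> real) \<Rightarrow> (real^'m) set \<Rightarrow> (real^'n) set \<Rightarrow> real \<Rightarrow> (nat \<Rightarrow> real)
      \<Rightarrow> (real^'m) \<times> (real^'n) \<Rightarrow> nat \<Rightarrow> (real^'m) \<times> (real^'n)" where
  "zoceg_plus f X Y \<eta> r z0 k =
     (let z = zoceg_iter f X Y \<eta> r z0 k in zoceg_step f X Y \<eta> (r k) z z)"

text \<open>The shifted points at which the two estimators evaluate the objective.  They may lie
  outside \<open>X \<times> Y\<close> although the base point \<open>z\<close> lies in it, so a smoothness assumption confined
  to \<open>X \<times> Y\<close> does not control the estimators.\<close>

definition query_points ::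
    "(real^'m) \<times> (real^'n) \<Rightarrow> real \<Rightarrow> ((real^'m) \<times> (real^'n)) set" where
  "query_points z r =
     range (\<lambda>i. (fst z + r *\<^sub>R axis i 1, snd z)) \<union> range (\<lambda>j. (fst z, snd z + r *\<^sub>R axis j 1))"

end

theory Submission
  imports Defs
begin

text \<open>
  With the monotone field \<open>F = (\<nabla>\<^sub>x f, - \<nabla>\<^sub>y f)\<close> the algorithm is the extragradient method with an
  inexact field. The descent lemma bounds the error of the field at radius \<open>r\<close> by
  \<open>\<delta> = (sqrt d\<^sub>x + sqrt d\<^sub>y) * L * r / 2\<close>. Compared with the exact method, one step loses at most
  \<open>4 * \<eta> * \<delta> * D\<close> in the difference of the field at the two points and at most \<open>2 * \<eta> * \<delta> * D\<close> in
  the comparison with \<open>F\<close>; the terms quadratic in the step are absorbed because \<open>\<eta> * L \<le> 1 / 2\<close>.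
  Telescoping the squared distances to the saddle point and Jensen's inequality finish the proof.
\<close>

section \<open>First-order bounds along segments\<close>

lemma GDERIV_line:
  fixes f :: "'a::real_inner \<Rightarrow> real"
  assumes "GDERIV f (z + t *\<^sub>R h) :> D"
  shows "((\<lambda>t. f (z + t *\<^sub>R h)) has_real_derivative inner D h) (at t)"
proof -
  have f: "(f has_derivative (\<lambda>v. inner D v)) (at (z + t *\<^sub>R h))"
    using assms by (simp add: gderiv_def inner_commute)
  have "((\<lambda>t. z + t *\<^sub>R h) has_derivative (\<lambda>s. s *\<^sub>R h)) (at t)"
    by (auto intro!: derivative_eq_intros)
  from has_derivative_compose[OF this f] show ?thesis
    by (simp add: has_field_derivative_def mult_commute_abs)
qed

text \<open>Along the segment, \<open>\<phi>\<close> is \<open>f\<close> minus its linear part and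
  minus the quadratic allowance. Cauchy-Schwarz and the Lipschitz bound against \<open>z\<close>
  make its derivative nonpositive on [0, 1], so \<open>\<phi> 1 \<le> \<phi> 0\<close> gives the
  claim without an integral.\<close>

lemma descent_lemma_upper:
  fixes f :: "'a::real_inner \<Rightarrow> real"
  assumes "\<And>t. 0 \<le> t \<Longrightarrow> t \<le> 1 \<Longrightarrow> GDERIV f (z + t *\<^sub>R h) :> g (z + t *\<^sub>R h)"
    and "\<And>t. 0 \<le> t \<Longrightarrow> t \<le> 1 \<Longrightarrow> norm (g (z + t *\<^sub>R h) - g z) \<le> L * norm (t *\<^sub>R h)"
  shows "f (z + h) - f z - inner (g z) h \<le> L / 2 * (norm h)\<^sup>2"
proof -
  define \<phi> where "\<phi> t = f (z + t *\<^sub>R h) - t * inner (g z) h - L / 2 * t\<^sup>2 * (norm h)\<^sup>2" for t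
  have "\<phi> 1 \<le> \<phi> 0"
  proof (rule DERIV_nonpos_imp_nonincreasing[of 0 1])
    fix t :: real assume t: "0 \<le> t" "t \<le> 1"
    have "(\<phi> has_real_derivative inner (g (z + t *\<^sub>R h)) h - inner (g z) h - L * t * (norm h)\<^sup>2) (at t)"
      unfolding \<phi>_def
      by (rule derivative_eq_intros GDERIV_line assms(1) t refl | simp)+
    moreover have "inner (g (z + t *\<^sub>R h)) h - inner (g z) h \<le> L * t * (norm h)\<^sup>2"
    proof -
      have "inner (g (z + t *\<^sub>R h) - g z) h \<le> norm (g (z + t *\<^sub>R h) - g z) * norm h"
        by (rule norm_cauchy_schwarz)
      also have "\<dots> \<le> L * norm (t *\<^sub>R h) * norm h"
        by (intro mult_right_mono assms(2) t) simp
      finally show ?thesis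
        using t by (simp add: inner_diff_left power2_eq_square mult.assoc)
    qed
    ultimately show "\<exists>y. (\<phi> has_real_derivative y) (at t) \<and> y \<le> 0"
      by force
  qed simp
  then show ?thesis by (simp add: \<phi>_def)
qed

text \<open>Convexity of \<open>U\<close> keeps the segment inside the region of smoothness. The
  upper bound is then applied to \<open>f\<close> and to \<open>- f\<close>, whose gradient has the
  same Lipschitz constant.\<close>

lemma descent_lemma:
  fixes f :: "'a::real_inner \<Rightarrow> real"
  assumes "convex U" and "z \<in> U" and "z + h \<in> U"
    and der: "\<And>z. z \<in> U \<Longrightarrow> GDERIV f z :> g z"
    and lip: "\<And>z1 z2. z1 \<in> U \<Longrightarrow> z2 \<in> U \<Longrightarrow> norm (g z1 - g z2) \<le> L * norm (z1 - z2)"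
  shows "\<bar>f (z + h) - f z - inner (g z) h\<bar> \<le> L / 2 * (norm h)\<^sup>2"
proof -
  have seg: "z + t *\<^sub>R h \<in> U" if "0 \<le> t" "t \<le> 1" for t
    using convexD_alt[OF assms(1-3) that] by (simp add: algebra_simps)
  have lip': "norm (g (z + t *\<^sub>R h) - g z) \<le> L * norm (t *\<^sub>R h)" if "0 \<le> t" "t \<le> 1" for t
    using lip[OF seg[OF that] \<open>z \<in> U\<close>] by simp
  have "f (z + h) - f z - inner (g z) h \<le> L / 2 * (norm h)\<^sup>2"
    by (rule descent_lemma_upper) (intro der seg lip'; assumption)+
  moreover have "- f (z + h) - - f z - inner (- g z) h \<le> L / 2 * (norm h)\<^sup>2"
  proof (rule descent_lemma_upper[where f = "\<lambda>z. - f z" and g = "\<lambda>z. - g z"])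
    fix t :: real assume t: "0 \<le> t" "t \<le> 1"
    show "GDERIV (\<lambda>z. - f z) (z + t *\<^sub>R h) :> - g (z + t *\<^sub>R h)"
      by (intro GDERIV_minus der seg t)
    show "norm (- g (z + t *\<^sub>R h) - - g z) \<le> L * norm (t *\<^sub>R h)"
      using lip'[OF t] by (simp add: norm_minus_commute)
  qed
  ultimately show ?thesis by (intro abs_leI) auto
qed

text \<open>By convexity the difference quotients from \<open>x\<close> towards \<open>u\<close> are
  at most \<open>\<phi> u - \<phi> x\<close> for 0 < t < 1, and \<open>d\<close> is their limit from
  the right. Only a derivative along the line is asked for, so that slices of \<open>f\<close> in
  one variable fit.\<close>

lemma convex_on_ge_tangent:
  fixes \<phi> :: "'a::real_vector \<Rightarrow> real"
  assumes conv: "convex_on X \<phi>" and X: "x \<in> X" "u \<in> X"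
    and der: "((\<lambda>t. \<phi> (x + t *\<^sub>R (u - x))) has_real_derivative d) (at 0)"
  shows "d \<le> \<phi> u - \<phi> x"
proof (rule tendsto_upperbound)
  show "((\<lambda>t. (\<phi> (x + t *\<^sub>R (u - x)) - \<phi> x) / t) \<longlongrightarrow> d) (at_right 0)"
    using has_field_derivative_at_within[OF der, of "{0<..}"]
    by (simp add: has_field_derivative_iff)
  have "(\<phi> (x + t *\<^sub>R (u - x)) - \<phi> x) / t \<le> \<phi> u - \<phi> x" if "0 < t" "t < 1" for t :: real
  proof -
    have "\<phi> ((1 - t) *\<^sub>R x + t *\<^sub>R u) \<le> (1 - t) * \<phi> x + t * \<phi> u"
      using that by (intro convex_onD[OF conv] X) auto
    then have "\<phi> (x + t *\<^sub>R (u - x)) - \<phi> x \<le> (\<phi> u - \<phi> x) * t"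
      by (simp add: algebra_simps)
    then show ?thesis
      using that by (simp add: divide_le_eq)
  qed
  then show "\<forall>\<^sub>F t in at_right 0. (\<phi> (x + t *\<^sub>R (u - x)) - \<phi> x) / t \<le> \<phi> u - \<phi> x"
    using eventually_at_right_real[of 0 "1::real"] by (auto elim!: eventually_mono)
qed simp

section \<open>Error of the finite-difference field\<close>

lemma norm_le_sqrt_card:
  fixes v :: "real^'n"
  assumes "\<And>i. \<bar>v $ i\<bar> \<le> B"
  shows "norm v \<le> sqrt (real CARD('n)) * B"
proof -
  \<comment> \<open>The index type is inhabited, so a single coordinate forces \<open>B\<close> to
    be nonnegative.\<close>
  have "0 \<le> B" using assms[of undefined] by linarith
  have "norm v \<le> L2_set (\<lambda>i::'n. B) UNIV"
    unfolding norm_vec_def using assms by (intro L2_set_mono) auto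
  also have "\<dots> = sqrt (real CARD('n)) * B"
    using \<open>0 \<le> B\<close> by (simp add: L2_set_def real_sqrt_mult)
  finally show ?thesis .
qed

text \<open>The minus sign turns ascent in the second block into descent:
  \<open>z - \<eta> *\<^sub>R zo_field f w r\<close> is the point that \<open>zoceg_step\<close>
  projects.\<close>

definition zo_field ::
    "((real^'m) \<times> (real^'n) \<Rightarrow> real) \<Rightarrow> (real^'m) \<times> (real^'n) \<Rightarrow> real \<Rightarrow> (real^'m) \<times> (real^'n)" where
  "zo_field f z r = (zo_grad_x f z r, - zo_grad_y f z r)"

text \<open>Applied to the gradient it yields the field \<open>F\<close>. Being an isometry, it
  hands the Lipschitz constant of the gradient on to \<open>F\<close>.\<close>

definition flip_snd :: "'a \<times> 'b::ab_group_add \<Rightarrow> 'a \<times> 'b" where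
  "flip_snd z = (fst z, - snd z)"

lemma norm_flip_snd_diff:
  fixes u v :: "'a::real_normed_vector \<times> 'b::real_normed_vector"
  shows "norm (flip_snd u - flip_snd v) = norm (u - v)"
  by (simp add: flip_snd_def norm_prod_def norm_minus_commute)

lemma zo_grad_x_nth: "zo_grad_x f z r $ i = (f (fst z + r *\<^sub>R axis i 1, snd z) - f z) / r"
  by (simp add: zo_grad_x_def axis_def if_distrib[of "\<lambda>x. _ * x"] cong: if_cong)

lemma zo_grad_y_nth: "zo_grad_y f z r $ j = (f (fst z, snd z + r *\<^sub>R axis j 1) - f z) / r"
  by (simp add: zo_grad_y_def axis_def if_distrib[of "\<lambda>x. _ * x"] cong: if_cong)

text \<open>Each coordinate of the error is that of one forward difference, at most
  \<open>L * r / 2\<close> by the descent lemma on the segment from \<open>z\<close> to a query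
  point; hence \<open>U\<close> is convex and contains these points. Passing from coordinates to
  norms gives one square root per block.\<close>

lemma zo_field_error:
  fixes f :: "(real^'m) \<times> (real^'n) \<Rightarrow> real"
  assumes U: "convex U" "z \<in> U" "query_points z r \<subseteq> U" and r: "r > 0"
    and der: "\<And>z. z \<in> U \<Longrightarrow> GDERIV f z :> g z"
    and lip: "\<And>z1 z2. z1 \<in> U \<Longrightarrow> z2 \<in> U \<Longrightarrow> norm (g z1 - g z2) \<le> L * norm (z1 - z2)"
  shows "norm (zo_field f z r - flip_snd (g z))
    \<le> (sqrt (real CARD('m)) + sqrt (real CARD('n))) * (L * r / 2)"
proof -
  \<comment> \<open>One estimate for both blocks: \<open>h\<close> is the shift and \<open>d\<close>
    the gradient coordinate in its direction. Division by \<open>r\<close> removes one factor from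
    the quadratic remainder.\<close>
  have quotient: "\<bar>(f (z + h) - f z) / r - d\<bar> \<le> L * r / 2"
    if "z + h \<in> U" "norm h = r" "inner (g z) h = r * d" for h d
  proof -
    have "\<bar>(f (z + h) - f z) / r - d\<bar> * r = \<bar>f (z + h) - f z - inner (g z) h\<bar>"
    proof -
      have "(f (z + h) - f z) / r - d = (f (z + h) - f z - inner (g z) h) / r"
        using r that by (simp add: field_simps)
      then show ?thesis using r by simp
    qed
    also have "\<dots> \<le> L / 2 * r\<^sup>2"
      using descent_lemma[OF U(1,2) that(1) der lip] that(2) by simp
    finally have "\<bar>(f (z + h) - f z) / r - d\<bar> * r \<le> (L * r / 2) * r"
      by (simp add: power2_eq_square)
    then show ?thesis using r by simp
  qed
  have x: "norm (zo_grad_x f z r - fst (g z)) \<le> sqrt (real CARD('m)) * (L * r / 2)"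
  proof (rule norm_le_sqrt_card)
    fix i :: 'm
    have "z + (r *\<^sub>R axis i 1, 0) \<in> U"
      using U(3) by (auto simp: query_points_def plus_prod_def)
    from quotient[OF this, of "fst (g z) $ i"] r
    show "\<bar>(zo_grad_x f z r - fst (g z)) $ i\<bar> \<le> L * r / 2"
      by (simp add: zo_grad_x_nth plus_prod_def norm_Pair inner_Pair_0 inner_axis)
  qed
  have y: "norm (zo_grad_y f z r - snd (g z)) \<le> sqrt (real CARD('n)) * (L * r / 2)"
  proof (rule norm_le_sqrt_card)
    fix j :: 'n
    have "z + (0, r *\<^sub>R axis j 1) \<in> U"
      using U(3) by (auto simp: query_points_def plus_prod_def)
    from quotient[OF this, of "snd (g z) $ j"] r
    show "\<bar>(zo_grad_y f z r - snd (g z)) $ j\<bar> \<le> L * r / 2"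
      by (simp add: zo_grad_y_nth plus_prod_def norm_Pair inner_Pair_0 inner_axis)
  qed
  have "norm (zo_field f z r - flip_snd (g z))
      = norm (zo_grad_x f z r - fst (g z), zo_grad_y f z r - snd (g z))"
    by (simp add: zo_field_def flip_snd_def norm_prod_def norm_minus_commute)
  also have "\<dots> \<le> norm (zo_grad_x f z r - fst (g z)) + norm (zo_grad_y f z r - snd (g z))"
    by (rule norm_Pair_le)
  also have "\<dots> \<le> (sqrt (real CARD('m)) + sqrt (real CARD('n))) * (L * r / 2)"
    using x y by (simp add: algebra_simps)
  finally show ?thesis .
qed

section \<open>One step of the inexact extragradient method\<close>

lemma zoceg_step_mem:
  assumes "closed X" "X \<noteq> {}" "closed Y" "Y \<noteq> {}"
  shows "zoceg_step f X Y \<eta> r z w \<in> X \<times> Y"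
  using assms by (simp add: zoceg_step_def closest_point_in_set)

text \<open>The obtuse-angle property of the projections onto \<open>X\<close> and onto
  \<open>Y\<close>, added up over the two blocks.\<close>

lemma zoceg_step_dot:
  fixes f :: "(real^'m) \<times> (real^'n) \<Rightarrow> real"
    and X :: "(real^'m) set" and Y :: "(real^'n) set"
    and \<eta> r :: real and z w :: "(real^'m) \<times> (real^'n)"
  assumes "convex X" "closed X" "convex Y" "closed Y" and "u \<in> X \<times> Y"
  defines "p \<equiv> zoceg_step f X Y \<eta> r z w"
  shows "inner (z - \<eta> *\<^sub>R zo_field f w r - p) (u - p) \<le> 0"
proof -
  have "inner (fst z - \<eta> *\<^sub>R zo_grad_x f w r - fst p) (fst u - fst p) \<le> 0"
    "inner (snd z + \<eta> *\<^sub>R zo_grad_y f w r - snd p) (snd u - snd p) \<le> 0"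
    using assms(1-5) by (auto simp: p_def zoceg_step_def intro!: closest_point_dot)
  then show ?thesis by (simp add: inner_prod_def zo_field_def)
qed

text \<open>Split \<open>inner b (p - u)\<close> into the terms \<open>inner b (q - u)\<close>,
  \<open>inner a (p - q)\<close> and \<open>inner (b - a) (p - q)\<close>. The hypotheses bound the
  first two; after polarization the squared distance from \<open>z\<close> to \<open>q\<close>
  cancels.\<close>

lemma extragradient_step:
  fixes z :: "'a::real_inner"
  assumes "inner (z - a - p) (q - p) \<le> 0" and "inner (z - b - q) (u - q) \<le> 0"
  shows "2 * inner b (p - u) \<le> (norm (z - u))\<^sup>2 - (norm (q - u))\<^sup>2
    - (norm (p - z))\<^sup>2 - (norm (p - q))\<^sup>2 + 2 * inner (b - a) (p - q)"
  using assms unfolding power2_norm_eq_inner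
  by (simp add: inner_diff_left inner_diff_right inner_commute algebra_simps)

text \<open>\<open>a\<close> and \<open>b\<close> estimate the exact fields \<open>A\<close> at
  \<open>z\<close> and \<open>B\<close> at \<open>p\<close>; \<open>q\<close> is the new iterate and
  \<open>u\<close> the point of comparison.\<close>

lemma inexact_extragradient_step:
  fixes z :: "'a::real_inner"
  assumes pq: "inner (z - \<eta> *\<^sub>R a - p) (q - p) \<le> 0" "inner (z - \<eta> *\<^sub>R b - q) (u - q) \<le> 0"
    and err: "norm (a - A) \<le> \<delta>" "norm (b - B) \<le> \<delta>"
    and lip: "norm (B - A) \<le> L * norm (p - z)"
    and \<eta>: "0 \<le> \<eta>" "\<eta> * L \<le> 1 / 2"
    and D: "norm (p - q) \<le> D" "norm (p - u) \<le> D"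
  shows "2 * \<eta> * inner B (p - u) \<le> (norm (z - u))\<^sup>2 - (norm (q - u))\<^sup>2 + 6 * \<eta> * \<delta> * D"
proof -
  define s t where "s = norm (p - z)" and "t = norm (p - q)"
  have \<delta>: "0 \<le> \<delta>" using err(1) norm_ge_zero order_trans by blast
  have st: "0 \<le> s" "0 \<le> t" "t \<le> D" using D by (auto simp: s_def t_def)
  have "norm (b - a) \<le> norm (b - B) + norm (B - A) + norm (A - a)"
    using norm_triangle_ineq[of "b - B" "B - A"] norm_triangle_ineq[of "b - A" "A - a"]
    by simp
  then have ba: "norm (b - a) \<le> L * s + 2 * \<delta>"
    using err lip by (simp add: norm_minus_commute s_def)
  have "2 * \<eta> * inner (b - a) (p - q) \<le> 2 * \<eta> * ((L * s + 2 * \<delta>) * t)"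
    using \<eta>(1) st ba norm_cauchy_schwarz[of "b - a" "p - q"] mult_right_mono[OF ba st(2)]
    by (intro mult_left_mono) (auto simp: t_def)
  also have "\<dots> = 2 * ((\<eta> * L) * (s * t)) + 4 * (\<eta> * \<delta> * t)"
    by (simp add: algebra_simps)
  \<comment> \<open>The step size bound reduces the Lipschitz part to \<open>s * t\<close>, which
    the negative squares in \<open>extragradient_step\<close> absorb. The 4 is twice the two errors
    contained in \<open>b - a\<close>.\<close>
  also have "\<dots> \<le> 2 * (1 / 2 * (s * t)) + 4 * (\<eta> * \<delta> * D)"
    using \<eta> st \<delta> by (intro add_mono mult_left_mono mult_right_mono) auto
  also have "\<dots> \<le> s\<^sup>2 + t\<^sup>2 + 4 * (\<eta> * \<delta> * D)"
  proof -
    have "0 \<le> (s - t)\<^sup>2 + s * t" using st by simp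
    moreover have "(s - t)\<^sup>2 + s * t = s\<^sup>2 + t\<^sup>2 - s * t" by (simp add: power2_eq_square algebra_simps)
    ultimately show ?thesis by simp
  qed
  finally have cross: "2 * \<eta> * inner (b - a) (p - q) \<le> s\<^sup>2 + t\<^sup>2 + 4 * (\<eta> * \<delta> * D)" .
  \<comment> \<open>Replacing the estimate \<open>b\<close> by the exact \<open>B\<close> costs the
    remaining 2 of the constant 6.\<close>
  have "inner (B - b) (p - u) \<le> norm (B - b) * norm (p - u)" by (rule norm_cauchy_schwarz)
  also have "\<dots> \<le> \<delta> * D"
    using err(2) D(2) \<delta> by (intro mult_mono) (auto simp: norm_minus_commute)
  finally have "2 * \<eta> * inner (B - b) (p - u) \<le> 2 * \<eta> * (\<delta> * D)"
    using \<eta>(1) by (intro mult_left_mono) auto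
  moreover have "2 * \<eta> * inner b (p - u)
      \<le> (norm (z - u))\<^sup>2 - (norm (q - u))\<^sup>2 - s\<^sup>2 - t\<^sup>2 + 2 * \<eta> * inner (b - a) (p - q)"
    using extragradient_step[OF pq] unfolding s_def t_def
    by (simp add: mult.assoc flip: scaleR_diff_right)
  ultimately show ?thesis
    using cross by (simp add: inner_diff_left algebra_simps)
qed

section \<open>The duality gap and its average\<close>

lemma duality_gap_le_inner:
  fixes f :: "'a::real_inner \<times> 'b::real_inner \<Rightarrow> real"
  assumes p: "p \<in> X \<times> Y" and u: "u \<in> X \<times> Y" and der: "GDERIV f p :> g"
    and cx: "\<And>y. y \<in> Y \<Longrightarrow> convex_on X (\<lambda>x. f (x, y))"
    and cy: "\<And>x. x \<in> X \<Longrightarrow> concave_on Y (\<lambda>y. f (x, y))"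
  shows "duality_gap f u p \<le> inner (flip_snd g) (p - u)"
proof -
  obtain x y x' y' where [simp]: "p = (x, y)" "u = (x', y')" by fastforce
  \<comment> \<open>The value \<open>f (x, y)\<close> is inserted between the two terms of the gap.
    Each half is a tangent inequality at \<open>p\<close>, for the convex slice in the first
    variable and the negated concave slice in the second.\<close>
  have "inner g (x' - x, 0) \<le> f (x', y) - f (x, y)"
  proof (rule convex_on_ge_tangent[where \<phi> = "\<lambda>x. f (x, y)"])
    show "((\<lambda>t. f (x + t *\<^sub>R (x' - x), y)) has_real_derivative inner g (x' - x, 0)) (at 0)"
      using GDERIV_line[of f p 0 "(x' - x, 0)" g] der by simp
  qed (use p u cx in auto)
  moreover have "- inner g (0, y' - y) \<le> - f (x, y') - - f (x, y)"
  proof (rule convex_on_ge_tangent[where \<phi> = "\<lambda>y. - f (x, y)"])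
    show "((\<lambda>t. - f (x, y + t *\<^sub>R (y' - y))) has_real_derivative - inner g (0, y' - y)) (at 0)"
      using GDERIV_line[of f p 0 "(0, y' - y)" g] der by (auto intro!: DERIV_minus)
  qed (use p u cy in \<open>auto simp: concave_on_def\<close>)
  ultimately show ?thesis
    by (simp add: duality_gap_def flip_snd_def inner_prod_def inner_diff_right)
qed

text \<open>Jensen's inequality with equal weights: the gap is the sum of a convex slice through
  \<open>snd u\<close> and a negated concave slice through \<open>fst u\<close>.\<close>

lemma duality_gap_average_le:
  fixes f :: "'a::real_vector \<times> 'b::real_vector \<Rightarrow> real"
  assumes p: "\<And>k. p k \<in> X \<times> Y" and u: "u \<in> X \<times> Y" and K: "K > 0"
    and cx: "\<And>y. y \<in> Y \<Longrightarrow> convex_on X (\<lambda>x. f (x, y))"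
    and cy: "\<And>x. x \<in> X \<Longrightarrow> concave_on Y (\<lambda>y. f (x, y))"
  shows "duality_gap f u ((1 / real K) *\<^sub>R (\<Sum>k<K. p k)) \<le> (\<Sum>k<K. duality_gap f u (p k)) / real K"
proof -
  have mem: "fst (p k) \<in> X" "snd (p k) \<in> Y" "fst u \<in> X" "snd u \<in> Y" for k
    using p[of k] u by (auto simp: mem_Times_iff)
  have "f (\<Sum>k<K. (1 / real K) *\<^sub>R fst (p k), snd u) \<le> (\<Sum>k<K. 1 / real K * f (fst (p k), snd u))"
    by (rule convex_on_sum[OF _ _ cx]) (use K mem in auto)
  moreover have "- f (fst u, \<Sum>k<K. (1 / real K) *\<^sub>R snd (p k))
      \<le> (\<Sum>k<K. 1 / real K * - f (fst u, snd (p k)))"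
    by (rule convex_on_sum[OF _ _ cy[unfolded concave_on_def]]) (use K mem in auto)
  ultimately show ?thesis
    by (simp add: duality_gap_def fst_sum snd_sum scaleR_right.sum sum_negf sum_subtractf
        diff_divide_distrib flip: sum_divide_distrib)
qed

section \<open>Telescoping over the iterations\<close>

theorem theorem2:
  fixes f :: "(real^'m) \<times> (real^'n) \<Rightarrow> real"
    and grad_f :: "(real^'m) \<times> (real^'n) \<Rightarrow> (real^'m) \<times> (real^'n)"
    and X :: "(real^'m) set" and Y :: "(real^'n) set"
    and U :: "((real^'m) \<times> (real^'n)) set"
    and zs z0 :: "(real^'m) \<times> (real^'n)"
    and G L \<eta> M\<^sub>3 :: real and r :: "nat \<Rightarrow> real" and K :: nat
  assumes "compact X" and "convex X" and "compact Y" and "convex Y"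
    and "convex U" and "X \<times> Y \<subseteq> U"
    and "\<And>k. query_points (zoceg_iter f X Y \<eta> r z0 k) (r k) \<subseteq> U"
    and "\<And>k. query_points (zoceg_plus f X Y \<eta> r z0 k) (r k) \<subseteq> U"
    and "\<And>z. z \<in> U \<Longrightarrow> GDERIV f z :> grad_f z"
    and "continuous_on U grad_f"
    and "\<And>z1 z2. z1 \<in> U \<Longrightarrow> z2 \<in> U \<Longrightarrow> norm (grad_f z1 - grad_f z2) \<le> L * norm (z1 - z2)"
    and "\<And>y. y \<in> Y \<Longrightarrow> convex_on X (\<lambda>x. f (x, y))"
    and "\<And>x. x \<in> X \<Longrightarrow> concave_on Y (\<lambda>y. f (x, y))"
    and "\<And>z1 z2. z1 \<in> X \<times> Y \<Longrightarrow> z2 \<in> X \<times> Y \<Longrightarrow> \<bar>f z1 - f z2\<bar> \<le> G * norm (z1 - z2)"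
    and "is_saddle_point f X Y zs"
    and "z0 \<in> X \<times> Y"
    and "\<And>k. r k > 0" and "summable r" and "M\<^sub>3 > 0"
    and "(\<Sum>k. r k) \<le> M\<^sub>3 / (sqrt (real CARD('m)) + sqrt (real CARD('n)))"
    and "\<eta> > 0" and "0 < \<eta> * L" and "\<eta> * L \<le> 1 / 2"
    and "K > 1"
  shows "duality_gap f zs ((1 / real K) *\<^sub>R (\<Sum>k<K. zoceg_plus f X Y \<eta> r z0 k))
           \<le> 1 / (2 * real K) * ((diameter (X \<times> Y))\<^sup>2 / \<eta> + 3 * L * M\<^sub>3 * diameter (X \<times> Y))"
proof -
  let ?c = "sqrt (real CARD('m)) + sqrt (real CARD('n))"
  let ?D = "diameter (X \<times> Y)"
  define z where "z = zoceg_iter f X Y \<eta> r z0"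
  define p where "p = zoceg_plus f X Y \<eta> r z0"
  have p_eq: "p k = zoceg_step f X Y \<eta> (r k) (z k) (z k)" for k
    by (simp add: p_def z_def zoceg_plus_def Let_def)
  have z_Suc: "z (Suc k) = zoceg_step f X Y \<eta> (r k) (z k) (p k)" for k
    by (simp add: p_eq) (simp add: z_def Let_def)
  have L: "L > 0" using \<open>\<eta> > 0\<close> \<open>0 < \<eta> * L\<close> by (simp add: zero_less_mult_iff)
  have zs: "zs \<in> X \<times> Y" using \<open>is_saddle_point f X Y zs\<close> by (simp add: is_saddle_point_def)
  have cl: "closed X" "closed Y" "X \<noteq> {}" "Y \<noteq> {}"
    using assms(1,3) zs by (auto intro: compact_imp_closed)
  have p_mem: "p k \<in> X \<times> Y" for k
    unfolding p_eq by (intro zoceg_step_mem cl)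
  have z_mem: "z k \<in> X \<times> Y" for k
  \<comment> \<open>No induction is necessary: a step lands in \<open>X \<times> Y\<close> wherever
    it starts.\<close>
  proof (cases k)
    case 0
    then show ?thesis using \<open>z0 \<in> X \<times> Y\<close> by (simp add: z_def)
  next
    case (Suc j)
    then show ?thesis unfolding Suc z_Suc by (intro zoceg_step_mem cl)
  qed
  have bd: "bounded (X \<times> Y)" using assms(1,3) by (intro bounded_Times compact_imp_bounded)
  have D: "norm (v - w) \<le> ?D" if "v \<in> X \<times> Y" "w \<in> X \<times> Y" for v w
    using diameter_bounded_bound[OF bd that] by (simp add: dist_norm)
  have D0: "0 \<le> ?D" using bd by (rule diameter_ge_0)
  have step: "2 * \<eta> * duality_gap f zs (p k)
      \<le> (norm (z k - zs))\<^sup>2 - (norm (z (Suc k) - zs))\<^sup>2 + 3 * \<eta> * L * ?c * ?D * r k" for k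
  proof -
    \<comment> \<open>The new iterate \<open>z (Suc k)\<close> tests the first projection and
      \<open>zs\<close> the second. The half in the field error turns the 6 into the 3 of
      \<open>step\<close>.\<close>
    have "2 * \<eta> * inner (flip_snd (grad_f (p k))) (p k - zs)
      \<le> (norm (z k - zs))\<^sup>2 - (norm (z (Suc k) - zs))\<^sup>2 + 6 * \<eta> * (?c * (L * r k / 2)) * ?D"
    proof (rule inexact_extragradient_step)
      show "inner (z k - \<eta> *\<^sub>R zo_field f (z k) (r k) - p k) (z (Suc k) - p k) \<le> 0"
        unfolding p_eq[of k] using z_mem by (intro zoceg_step_dot assms(2,4) cl)
      show "inner (z k - \<eta> *\<^sub>R zo_field f (p k) (r k) - z (Suc k)) (zs - z (Suc k)) \<le> 0"
        unfolding z_Suc using zs by (intro zoceg_step_dot assms(2,4) cl)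
      show "norm (zo_field f (z k) (r k) - flip_snd (grad_f (z k))) \<le> ?c * (L * r k / 2)"
        using z_mem[of k] assms(6) assms(7)[of k]
        by (intro zo_field_error[OF assms(5) _ _ _ assms(9,11)] assms(17)) (auto simp: z_def)
      show "norm (zo_field f (p k) (r k) - flip_snd (grad_f (p k))) \<le> ?c * (L * r k / 2)"
        using p_mem[of k] assms(6) assms(8)[of k]
        by (intro zo_field_error[OF assms(5) _ _ _ assms(9,11)] assms(17)) (auto simp: p_def)
      show "norm (flip_snd (grad_f (p k)) - flip_snd (grad_f (z k))) \<le> L * norm (p k - z k)"
        unfolding norm_flip_snd_diff
        using z_mem[of k] p_mem[of k] assms(6) by (intro assms(11)) auto
    qed (use \<open>\<eta> > 0\<close> \<open>\<eta> * L \<le> 1 / 2\<close> in \<open>auto intro!: D p_mem z_mem zs\<close>)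
    moreover have "duality_gap f zs (p k) \<le> inner (flip_snd (grad_f (p k))) (p k - zs)"
      using p_mem[of k] assms(6)
      by (intro duality_gap_le_inner[OF p_mem zs _ assms(12,13)] assms(9)) auto
    then have "2 * \<eta> * duality_gap f zs (p k) \<le> 2 * \<eta> * inner (flip_snd (grad_f (p k))) (p k - zs)"
      using \<open>\<eta> > 0\<close> by simp
    ultimately show ?thesis by (simp add: algebra_simps)
  qed
  have c: "?c > 0" by (simp add: add_pos_pos)
  \<comment> \<open>Positive radii let the series dominate its partial sums; its assumed bound
    carries \<open>?c\<close> in the denominator, matching the \<open>?c\<close> of the field
    error.\<close>
  have "(\<Sum>k<K. r k) \<le> (\<Sum>k. r k)"
    using assms(17) by (intro sum_le_suminf assms(18)) (auto intro: less_imp_le)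
  also have "\<dots> \<le> M\<^sub>3 / ?c" by (rule assms(20))
  finally have r: "?c * (\<Sum>k<K. r k) \<le> M\<^sub>3"
    using c by (simp add: le_divide_eq mult.commute)
  have "2 * \<eta> * (\<Sum>k<K. duality_gap f zs (p k))
      \<le> (\<Sum>k<K. (norm (z k - zs))\<^sup>2 - (norm (z (Suc k) - zs))\<^sup>2 + 3 * \<eta> * L * ?c * ?D * r k)"
    unfolding sum_distrib_left by (intro sum_mono step)
  also have "\<dots> = (norm (z 0 - zs))\<^sup>2 - (norm (z K - zs))\<^sup>2
      + 3 * \<eta> * L * ?D * (?c * (\<Sum>k<K. r k))"
    unfolding sum.distrib sum_lessThan_telescope'[of "\<lambda>k. (norm (z k - zs))\<^sup>2"]
    by (simp only: sum_distrib_left[symmetric] mult.assoc mult.left_commute[of ?D])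
  \<comment> \<open>The last squared distance is dropped, and the first is at most the squared
    diameter.\<close>
  also have "\<dots> \<le> ?D\<^sup>2 - 0 + 3 * \<eta> * L * ?D * M\<^sub>3"
    using D[OF z_mem zs, of 0] r \<open>\<eta> > 0\<close> L D0
    by (intro add_mono diff_mono mult_left_mono power_mono) auto
  finally have "(\<Sum>k<K. duality_gap f zs (p k)) \<le> (?D\<^sup>2 / \<eta> + 3 * L * M\<^sub>3 * ?D) / 2"
    using \<open>\<eta> > 0\<close> by (simp add: field_simps)
  then have "(\<Sum>k<K. duality_gap f zs (p k)) / real K
      \<le> (?D\<^sup>2 / \<eta> + 3 * L * M\<^sub>3 * ?D) / 2 / real K"
    by (rule divide_right_mono) simp
  moreover have "duality_gap f zs ((1 / real K) *\<^sub>R (\<Sum>k<K. p k))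
      \<le> (\<Sum>k<K. duality_gap f zs (p k)) / real K"
    using \<open>K > 1\<close> by (intro duality_gap_average_le[OF p_mem zs _ assms(12,13)]) auto
  ultimately show ?thesis
    by (simp add: p_def)
qed

end
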